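(* Let $(\hat{a}_{n,L} : \Omega^n \to \mathbb{R})_{n \in \mathbb{N}, L > 0}$ be a family of estimators with the following property: for all $P \in \mathcal{P}$, there is a neighborhood $\mathcal{N}' \subseteq \mathcal{P}$ of $P$ such that for all $T > 0$ one has $$\lim_{L \to \infty} \sup_{Q \in \mathcal{N}'} \limsup_{n \to \infty} Q^n\big[n^{1/3} |\hat{a}_{n,L} - a(Q)| > T\big] = 0.$$ Then, for all $P \in \mathcal{P}$, there is a neighborhood $\mathcal{N} \subseteq \mathcal{P}$ of $P$ such that for all $T > 0$ one has $$\lim_{L \to \infty} \sup_{Q \in \mathcal{N}} \limsup_{n \to \infty} Q^n\big[L_Q(\hat{a}_{n,L}) > L_Q(a(Q)) + T n^{-2/3}\big] = 0.$$
   Context: Let $\Omega = [0,1] \times \{\pm 1\}$ with the Borel $\sigma$-field. Let $\tilde{\mathcal{P}}$ be the set of all probability measures $P$ on $\Omega$ having a density $f_P \in C^1([0,1]\times\{\pm 1\})$ with respect to (Lebesgue measure on $[0,1]$) $\otimes$ (counting measure on $\{\pm1\}$). Write $f_P^+ := f_P(\cdot,1)$ and $f_P^- := f_P(\cdot,-1)$. Endow $\tilde{\mathcal{P}}$ with the metric $d(P,Q) := \|f_P - f_Q\|_\infty + \|\partial_1 f_P - \partial_1 f_Q\|_\infty$, where $\partial_1$ is the derivative with respect to the first argument. Let $\mathcal{P} \subseteq \tilde{\mathcal{P}}$ be the set of all $P \in \tilde{\mathcal{P}}$ such that there is a unique point $a(P) \in [0,1]$ with $f_P^+(a(P)) = f_P^-(a(P))$,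 this point lies in the open interval $(0,1)$, and $(f_P^+)'(a(P)) > (f_P^-)'(a(P))$. $\mathcal{P}$ carries the topology induced by $d$. $Q^n$ denotes the $n$-fold product measure of $Q$ on $\Omega^n$. An estimator is a measurable function $\Omega^n \to \mathbb{R}$. For $\alpha \in \mathbb{R}$ let $h_\alpha(x) := 1$ if $x \geq \alpha$ and $h_\alpha(x) := -1$ if $x < \alpha$. The prediction error is $L_Q(\alpha) := Q[h_\alpha(X) \neq Y]$, where $(X,Y)$ is the identity (coordinate pair) on $\Omega$, distributed according to $Q$. $L_Q(\hat a_{n,L})$ denotes the composition of the function $L_Q$ with $\hat a_{n,L}$. *)

theory Defs
  imports "HOL-Probability.Probability"
begin

definition Omega :: "(real \<times> real) set" where
  "Omega = {0..1} \<times> {-1, 1}"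

definition Omega_borel :: "(real \<times> real) measure" where
  "Omega_borel = restrict_space borel Omega"

definition base_measure :: "(real \<times> real) measure" where
  "base_measure = restrict_space lborel {0..1} \<Otimes>\<^sub>M count_space {-1, 1}"

lemma space_base_measure: "space base_measure = Omega"
  by (simp add: base_measure_def Omega_def space_pair_measure space_restrict_space)

lemma space_Omega_borel: "space Omega_borel = Omega"
  by (simp add: Omega_borel_def space_restrict_space)

lemma sets_base_measure: "sets base_measure = sets Omega_borel"
proof
  have 2: "snd \<in> restrict_space borel Omega \<rightarrow>\<^sub>M count_space {-1, 1 :: real}"
  proof (rule measurable_count_space_eq2[THEN iffD2])
    show "finite {-1, 1 :: real}" by simp
    have "snd -` {a} \<inter> Omega \<in> sets (restrict_space borel Omega)" for a
    proof -
      have "closed (snd -` {a} :: (real \<times> real) set)"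
        by (intro closed_vimage closed_singleton continuous_on_snd continuous_on_id)
      then show ?thesis
        by (auto simp: sets_restrict_space Int_commute)
    qed
    then show "snd \<in> space (restrict_space borel Omega) \<rightarrow> {-1, 1} \<and>
      (\<forall>a\<in>{-1, 1 :: real}. snd -` {a} \<inter> space (restrict_space borel Omega)
          \<in> sets (restrict_space borel Omega))"
      by (auto simp: space_restrict_space Omega_def)
  qed
  have 1: "fst \<in> restrict_space borel Omega \<rightarrow>\<^sub>M restrict_space lborel {0..1 :: real}"
    by (intro measurable_restrict_space3)
       (auto simp: Omega_def intro!: borel_measurable_continuous_onI continuous_intros)
  have "(\<lambda>w. w) \<in> Omega_borel \<rightarrow>\<^sub>M base_measure"
    unfolding base_measure_def Omega_borel_def
    using 1 2 by (intro measurable_pair) (simp_all add: comp_def)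
  from measurable_sets[OF this] show "sets base_measure \<subseteq> sets Omega_borel"
    using sets.sets_into_space[of _ base_measure]
    by (auto simp: space_base_measure space_Omega_borel Int_absorb2 subset_iff)
next
  have 3: "fst \<in> base_measure \<rightarrow>\<^sub>M borel"
  proof -
    have "(\<lambda>x. x) \<in> restrict_space lborel {0..1 :: real} \<rightarrow>\<^sub>M borel"
      by (rule measurable_restrict_space1) simp
    then show ?thesis
      unfolding base_measure_def by (rule measurable_compose[OF measurable_fst])
  qed
  have 4: "snd \<in> base_measure \<rightarrow>\<^sub>M borel"
  proof -
    have "(\<lambda>x. x) \<in> count_space {-1, 1 :: real} \<rightarrow>\<^sub>M borel" by simp
    then show ?thesis
      unfolding base_measure_def by (rule measurable_compose[OF measurable_snd])
  qed
  have "(\<lambda>w. (fst w, snd w)) \<in> base_measure \<rightarrow>\<^sub>M borel"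
    by (rule borel_measurable_Pair[OF 3 4])
  then have "(\<lambda>w. w) \<in> base_measure \<rightarrow>\<^sub>M Omega_borel"
    unfolding Omega_borel_def
    by (intro measurable_restrict_space2) (auto simp: space_base_measure)
  from measurable_sets[OF this] show "sets Omega_borel \<subseteq> sets base_measure"
    using sets.sets_into_space[of _ Omega_borel]
    by (auto simp: space_base_measure space_Omega_borel Int_absorb2 subset_iff)
qed

text \<open>At the end points 0 and 1 the derivative is one-sided, as for functions in
  \<open>C\<^sup>1([0,1])\<close>; hence the filter \<open>at x within {0..1}\<close>.\<close>

definition partial1 :: "(real \<times> real \<Rightarrow> real) \<Rightarrow> real \<times> real \<Rightarrow> real" where
  "partial1 f = (\<lambda>(x, y). vector_derivative (\<lambda>t. f (t, y)) (at x within {0..1}))"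

definition C1_Omega :: "(real \<times> real \<Rightarrow> real) \<Rightarrow> bool" where
  "C1_Omega f \<longleftrightarrow> (\<forall>y\<in>{-1, 1}.
     (\<forall>x\<in>{0..1}. (\<lambda>t. f (t, y)) differentiable (at x within {0..1})) \<and>
     continuous_on {0..1} (\<lambda>x. partial1 f (x, y)))"

definition is_C1_density :: "(real \<times> real) measure \<Rightarrow> (real \<times> real \<Rightarrow> real) \<Rightarrow> bool" where
  "is_C1_density P f \<longleftrightarrow>
     C1_Omega f \<and> (\<forall>w\<in>Omega. 0 \<le> f w) \<and> P = density base_measure (\<lambda>w. ennreal (f w))"

definition P_tilde :: "(real \<times> real) measure set" where
  "P_tilde = {P. prob_space P \<and> sets P = sets Omega_borel \<and> (\<exists>f. is_C1_density P f)}"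

text \<open>The \<open>C\<^sup>1\<close> density is determined on \<^term>\<open>Omega\<close> (lemma \<open>is_C1_density_unique\<close>);
  its values elsewhere are arbitrary and are never used.\<close>

definition dens :: "(real \<times> real) measure \<Rightarrow> real \<times> real \<Rightarrow> real" where
  "dens P = (SOME f. is_C1_density P f)"

definition sup_norm :: "(real \<times> real \<Rightarrow> real) \<Rightarrow> real" where
  "sup_norm g = (SUP w\<in>Omega. \<bar>g w\<bar>)"

text \<open>The guard only serves \<^locale>\<open>Metric_space\<close>, which demands nonnegativity and symmetry of
  the distance on the whole type; the values outside \<^term>\<open>P_tilde\<close> play no role.\<close>

definition dP :: "(real \<times> real) measure \<Rightarrow> (real \<times> real) measure \<Rightarrow> real" where
  "dP P Q = (if P \<in> P_tilde \<and> Q \<in> P_tilde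
     then sup_norm (\<lambda>w. dens P w - dens Q w)
        + sup_norm (\<lambda>w. partial1 (dens P) w - partial1 (dens Q) w)
     else 0)"

definition crossing :: "(real \<times> real) measure \<Rightarrow> real" where
  "crossing P = (THE x. x \<in> {0..1} \<and> dens P (x, 1) = dens P (x, -1))"

definition P_class :: "(real \<times> real) measure set" where
  "P_class = {P \<in> P_tilde.
     (\<exists>!x. x \<in> {0..1} \<and> dens P (x, 1) = dens P (x, -1)) \<and>
     crossing P \<in> {0<..<1} \<and>
     partial1 (dens P) (crossing P, 1) > partial1 (dens P) (crossing P, -1)}"

text \<open>\<^term>\<open>dP\<close> is a metric on \<^term>\<open>P_tilde\<close> (lemma \<open>Metric_space_P_tilde\<close>).\<close>

definition P_topology :: "(real \<times> real) measure topology" where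
  "P_topology = subtopology (Metric_space.mtopology P_tilde dP) P_class"

definition nhd_of :: "(real \<times> real) measure \<Rightarrow> (real \<times> real) measure set \<Rightarrow> bool" where
  "nhd_of P N \<longleftrightarrow> N \<subseteq> P_class \<and> (\<exists>U. openin P_topology U \<and> P \<in> U \<and> U \<subseteq> N)"

definition power_measure :: "nat \<Rightarrow> (real \<times> real) measure \<Rightarrow> (nat \<Rightarrow> real \<times> real) measure" where
  "power_measure n Q = Pi\<^sub>M {..<n} (\<lambda>_. Q)"

definition estimator :: "nat \<Rightarrow> ((nat \<Rightarrow> real \<times> real) \<Rightarrow> real) \<Rightarrow> bool" where
  "estimator n g \<longleftrightarrow> g \<in> borel_measurable (Pi\<^sub>M {..<n} (\<lambda>_. Omega_borel))"

definition classifier :: "real \<Rightarrow> real \<Rightarrow> real" where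
  "classifier \<alpha> x = (if x \<ge> \<alpha> then 1 else -1)"

definition pred_error :: "(real \<times> real) measure \<Rightarrow> real \<Rightarrow> real" where
  "pred_error Q \<alpha> = measure Q {w \<in> space Q. classifier \<alpha> (fst w) \<noteq> snd w}"

lemma dens_is_C1_density: "P \<in> P_tilde \<Longrightarrow> is_C1_density P (dens P)"
  using someI_ex[of "is_C1_density P"] by (simp add: P_tilde_def dens_def)

lemma C1_Omega_continuous:
  assumes "C1_Omega f" "y \<in> {-1, 1}"
  shows "continuous_on {0..1} (\<lambda>x. f (x, y))"
  using assms unfolding C1_Omega_def
  by (intro differentiable_imp_continuous_on) (auto simp: differentiable_on_def)

lemma is_C1_density_measurable:
  assumes "is_C1_density P f"
  shows "f \<in> borel_measurable base_measure"
proof -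
  have C: "C1_Omega f" using assms by (simp add: is_C1_density_def)
  have m: "(\<lambda>x. f (x, y)) \<in> borel_measurable (restrict_space lborel {0..1})" if "y \<in> {-1, 1}" for y
    using borel_measurable_continuous_on_restrict[OF C1_Omega_continuous[OF C that]]
    by (subst measurable_cong_sets[OF sets_restrict_space_cong[OF sets_lborel] refl])
  show ?thesis
    unfolding base_measure_def
    by (rule measurable_compose_countable'[where f = "\<lambda>b a. f (fst a, b)" and g = snd
          and I = "{-1, 1}", simplified prod.collapse])
       (auto intro!: measurable_compose[OF measurable_fst m])
qed

lemma bounded_Omega:
  fixes g :: "real \<times> real \<Rightarrow> real"
  assumes "\<And>y. y \<in> {-1, 1} \<Longrightarrow> continuous_on {0..1} (\<lambda>x. g (x, y))"
  shows "bdd_above ((\<lambda>w. \<bar>g w\<bar>) ` Omega)"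
proof -
  have "compact ((\<lambda>x. g (x, y)) ` {0..1})" if "y \<in> {-1, 1}" for y
    using compact_continuous_image[OF assms[OF that]] by simp
  then have "bounded ((\<lambda>x. g (x, -1)) ` {0..1} \<union> (\<lambda>x. g (x, 1)) ` {0..1})"
    by (simp add: compact_imp_bounded)
  then obtain B where "\<forall>z\<in>(\<lambda>x. g (x, -1)) ` {0..1} \<union> (\<lambda>x. g (x, 1)) ` {0..1}. norm z \<le> B"
    unfolding bounded_iff by blast
  then show ?thesis
    by (intro bdd_aboveI[of _ B]) (auto simp: Omega_def)
qed

lemma sup_norm_upper:
  "bdd_above ((\<lambda>w. \<bar>g w\<bar>) ` Omega) \<Longrightarrow> w \<in> Omega \<Longrightarrow> \<bar>g w\<bar> \<le> sup_norm g"
  unfolding sup_norm_def by (rule cSUP_upper)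

lemma Omega_nonempty: "Omega \<noteq> {}"
  by (auto simp: Omega_def)

lemma sup_norm_triangle:
  assumes "bdd_above ((\<lambda>w. \<bar>f w - g w\<bar>) ` Omega)" "bdd_above ((\<lambda>w. \<bar>g w - h w\<bar>) ` Omega)"
  shows "sup_norm (\<lambda>w. f w - h w) \<le> sup_norm (\<lambda>w. f w - g w) + sup_norm (\<lambda>w. g w - h w)"
  unfolding sup_norm_def[of "\<lambda>w. f w - h w"]
proof (rule cSUP_least[OF Omega_nonempty])
  fix w assume w: "w \<in> Omega"
  from sup_norm_upper[OF assms(1) w] sup_norm_upper[OF assms(2) w]
  show "\<bar>f w - h w\<bar> \<le> sup_norm (\<lambda>w. f w - g w) + sup_norm (\<lambda>w. g w - h w)" by linarith
qed

lemma sup_norm_nonneg: "bdd_above ((\<lambda>w. \<bar>g w\<bar>) ` Omega) \<Longrightarrow> 0 \<le> sup_norm g"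
  using sup_norm_upper Omega_nonempty by fastforce

lemma bdd_dens_diff:
  assumes "P \<in> P_tilde" "Q \<in> P_tilde"
  shows "bdd_above ((\<lambda>w. \<bar>dens P w - dens Q w\<bar>) ` Omega)"
    and "bdd_above ((\<lambda>w. \<bar>partial1 (dens P) w - partial1 (dens Q) w\<bar>) ` Omega)"
proof -
  have C: "C1_Omega (dens P)" "C1_Omega (dens Q)"
    using assms dens_is_C1_density by (auto simp: is_C1_density_def)
  show "bdd_above ((\<lambda>w. \<bar>dens P w - dens Q w\<bar>) ` Omega)"
    using C by (intro bounded_Omega continuous_intros C1_Omega_continuous)
  show "bdd_above ((\<lambda>w. \<bar>partial1 (dens P) w - partial1 (dens Q) w\<bar>) ` Omega)"
    using C unfolding C1_Omega_def by (intro bounded_Omega continuous_intros) auto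
qed

lemma Metric_space_P_tilde: "Metric_space P_tilde dP"
proof
  fix P Q R
  show "0 \<le> dP P Q"
    by (auto simp: dP_def intro!: add_nonneg_nonneg sup_norm_nonneg bdd_dens_diff)
  show "dP P Q = dP Q P"
    by (simp add: dP_def sup_norm_def abs_minus_commute)
  assume P: "P \<in> P_tilde" and Q: "Q \<in> P_tilde"
  show "dP P Q = 0 \<longleftrightarrow> P = Q"
  proof
    assume "P = Q"
    then show "dP P Q = 0"
      by (simp add: dP_def sup_norm_def Omega_nonempty)
  next
    assume "dP P Q = 0"
    then have "sup_norm (\<lambda>w. dens P w - dens Q w) = 0"
      using P Q sup_norm_nonneg[OF bdd_dens_diff(1)[OF P Q]]
        sup_norm_nonneg[OF bdd_dens_diff(2)[OF P Q]]
      by (simp add: dP_def add_nonneg_eq_0_iff)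
    then have "dens P w = dens Q w" if "w \<in> Omega" for w
      using sup_norm_upper[OF bdd_dens_diff(1)[OF P Q] that] by simp
    then have "density base_measure (\<lambda>w. ennreal (dens P w)) =
        density base_measure (\<lambda>w. ennreal (dens Q w))"
      using is_C1_density_measurable[OF dens_is_C1_density[OF P]]
        is_C1_density_measurable[OF dens_is_C1_density[OF Q]]
      by (intro density_cong) (auto simp: space_base_measure)
    then show "P = Q"
      using P Q dens_is_C1_density unfolding is_C1_density_def by metis
  qed
  assume R: "R \<in> P_tilde"
  show "dP P R \<le> dP P Q + dP Q R"
    using sup_norm_triangle[OF bdd_dens_diff(1)[OF P Q] bdd_dens_diff(1)[OF Q R]]
      sup_norm_triangle[OF bdd_dens_diff(2)[OF P Q] bdd_dens_diff(2)[OF Q R]]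
    by (simp add: dP_def P Q R)
qed

lemma is_C1_density_unique:
  assumes f: "is_C1_density P f" and g: "is_C1_density P g" and w: "w \<in> Omega"
  shows "f w = g w"
proof -
  interpret A: sigma_finite_measure "restrict_space lborel {0..1 :: real}"
    by (intro sigma_finite_measure_restrict_space sigma_finite_lborel) simp
  interpret B: sigma_finite_measure "count_space {-1, 1 :: real}"
    by (rule sigma_finite_measure_count_space_finite) simp
  interpret AB: pair_sigma_finite "restrict_space lborel {0..1 :: real}" "count_space {-1, 1 :: real}" ..
  have sf: "sigma_finite_measure base_measure"
    unfolding base_measure_def by (rule AB.sigma_finite_measure_axioms)
  have "AE w in base_measure. ennreal (f w) = ennreal (g w)"
    using f g by (intro sigma_finite_measure.density_unique[OF sf])
      (auto simp: is_C1_density_def intro!: measurable_compose[OF is_C1_density_measurable] f g)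
  then obtain N where N: "N \<in> null_sets base_measure"
    "{w \<in> space base_measure. ennreal (f w) \<noteq> ennreal (g w)} \<subseteq> N"
    by (auto elim!: AE_E intro: null_setsI)
  have neN: "w \<in> N" if "w \<in> Omega" "f w \<noteq> g w" for w
    using N(2) that f g by (auto simp: space_base_measure is_C1_density_def)
  obtain x y where xy: "w = (x, y)" "x \<in> {0..1}" "y \<in> {-1, 1}"
    using w by (auto simp: Omega_def)
  show ?thesis
  proof (rule ccontr)
    assume ne: "f w \<noteq> g w"
    define k where "k t = f (t, y) - g (t, y)" for t
    have "continuous_on {0..1} k"
      unfolding k_def using f g xy(3)
      by (intro continuous_intros C1_Omega_continuous) (auto simp: is_C1_density_def)
    moreover have "k x \<noteq> 0" using ne xy by (simp add: k_def)
    ultimately obtain e where e: "e > 0"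
      "\<And>t. t \<in> {0..1} \<Longrightarrow> dist t x < e \<Longrightarrow> dist (k t) (k x) < \<bar>k x\<bar>"
      using xy(2) unfolding continuous_on_iff by (metis zero_less_abs_iff)
    have kn: "k t \<noteq> 0" if "t \<in> {0..1}" "dist t x < e" for t
      using e(2)[OF that] by (auto simp: dist_real_def)
    define c where "c = max 0 (x - e / 2)"
    define d where "d = min 1 (x + e / 2)"
    have cd: "c < d" "0 \<le> c" "d \<le> 1" "x - e < c" "d < x + e"
      using xy(2) e(1) by (auto simp: c_def d_def)
    have sub: "{c..d} \<times> {y} \<subseteq> N"
    proof
      fix v assume "v \<in> {c..d} \<times> {y}"
      then obtain t where t: "v = (t, y)" "c \<le> t" "t \<le> d" by auto
      have "t \<in> {0..1}" "dist t x < e" using t cd by (auto simp: dist_real_def)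
      from kn[OF this] this xy(3) t(1) show "v \<in> N"
        by (intro neN) (auto simp: k_def Omega_def)
    qed
    have "emeasure base_measure ({c..d} \<times> {y}) =
        emeasure (restrict_space lborel {0..1}) {c..d} * emeasure (count_space {-1, 1}) {y}"
      unfolding base_measure_def using cd xy(3)
      by (intro B.emeasure_pair_measure_Times) (auto simp: sets_restrict_space_iff)
    also have "\<dots> = ennreal (d - c)"
      using cd xy(3) by (subst emeasure_restrict_space) auto
    finally have "emeasure base_measure ({c..d} \<times> {y}) = ennreal (d - c)" .
    moreover have "emeasure base_measure ({c..d} \<times> {y}) \<le> emeasure base_measure N"
      using sub N(1) by (intro emeasure_mono) auto
    ultimately show False using N(1) cd(1) by (simp add: null_setsD1 ennreal_eq_0_iff)
  qed
qed

end

theory Submission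
  imports Defs
begin

text \<open>The excess prediction error \<open>L\<^sub>Q(\<alpha>) - L\<^sub>Q(a(Q))\<close> is at most the integral of
  \<open>\<bar>f\<^sub>Q\<^sup>+ - f\<^sub>Q\<^sup>-\<bar>\<close> over the interval of radius \<open>\<bar>\<alpha> - a(Q)\<bar>\<close> around \<open>a(Q)\<close>, where this integrand
  vanishes at the centre. On a \<open>d\<close>-ball around \<open>P\<close> the derivatives of the densities are uniformly
  bounded, so the excess error is at most a uniform constant times \<open>(\<alpha> - a(Q))\<^sup>2\<close>, and the rate
  \<open>n\<^sup>-\<^sup>1\<^sup>/\<^sup>3\<close> for the estimator becomes the rate \<open>n\<^sup>-\<^sup>2\<^sup>/\<^sup>3\<close> for the prediction error.\<close>

lemma C1_Omega_lipschitz: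
  assumes f: "C1_Omega f"
    and K: "\<And>w. w \<in> Omega \<Longrightarrow> \<bar>partial1 f w\<bar> \<le> K"
    and y: "y \<in> {-1, 1}" and xz: "x \<in> {0..1}" "z \<in> {0..1}"
  shows "\<bar>f (x, y) - f (z, y)\<bar> \<le> K * \<bar>x - z\<bar>"
proof -
  have "norm (f (x, y) - f (z, y)) \<le> K * norm (x - z)"
  \<comment> \<open>The derivatives at 0 and 1 are one-sided, so the mean value inequality is used
    in its form for derivatives within the convex set \<open>{0..1}\<close>.\<close>
  proof (rule field_differentiable_bound[where S = "{0..1::real}" and f' = "\<lambda>t. partial1 f (t, y)"
        and f = "\<lambda>t. f (t, y)"])
    fix t :: real assume t: "t \<in> {0..1}"
    have "(\<lambda>t. f (t, y)) differentiable (at t within {0..1})"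
      using f y t by (auto simp: C1_Omega_def)
    then have "((\<lambda>t. f (t, y)) has_vector_derivative partial1 f (t, y)) (at t within {0..1})"
      by (simp add: partial1_def vector_derivative_works)
    then show "((\<lambda>t. f (t, y)) has_field_derivative partial1 f (t, y)) (at t within {0..1})"
      by (simp add: has_real_derivative_iff_has_vector_derivative)
    show "norm (partial1 f (t, y)) \<le> K"
      using K[of "(t, y)"] t y by (auto simp: Omega_def)
  qed (use xz in auto)
  then show ?thesis by simp
qed

lemma misclassified_sets:
  "{w \<in> Omega. classifier \<alpha> (fst w) \<noteq> snd w} \<in> sets base_measure"
proof -
  have "fst \<in> borel_measurable Omega_borel" "snd \<in> borel_measurable Omega_borel"
    unfolding Omega_borel_def
    by (auto intro!: measurable_restrict_space1 borel_measurable_continuous_onI continuous_intros)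
  then have "{w \<in> space Omega_borel. classifier \<alpha> (fst w) \<noteq> snd w} \<in> sets Omega_borel"
    unfolding classifier_def by measurable
  then show ?thesis by (simp add: sets_base_measure space_Omega_borel)
qed

text \<open>At each \<open>x\<close> exactly one label is misclassified: 1 to the left of the
  threshold, -1 from the threshold on. Integrating out the label leaves a single density value, so
  the errors at two thresholds can be compared pointwise in \<open>x\<close>.\<close>

lemma emeasure_misclassified:
  assumes Q: "Q \<in> P_tilde"
  shows "emeasure Q {w \<in> space Q. classifier \<alpha> (fst w) \<noteq> snd w} =
    (\<integral>\<^sup>+x. ennreal (dens Q (x, if x < \<alpha> then 1 else -1)) \<partial>restrict_space lborel {0..1})"
proof -
  interpret B: sigma_finite_measure "count_space {-1, 1 :: real}"
    by (rule sigma_finite_measure_count_space_finite) simp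
  define A where "A = {w \<in> Omega. classifier \<alpha> (fst w) \<noteq> snd w}"
  have d: "is_C1_density Q (dens Q)" by (rule dens_is_C1_density[OF Q])
  have Qd: "Q = density base_measure (\<lambda>w. ennreal (dens Q w))"
    using d by (simp add: is_C1_density_def)
  have m: "(\<lambda>w. ennreal (dens Q w)) \<in> borel_measurable base_measure"
    by (intro measurable_compose[OF is_C1_density_measurable[OF d]]) simp
  have A: "A \<in> sets base_measure" unfolding A_def by (rule misclassified_sets)
  have "space Q = Omega" by (subst Qd) (simp add: space_base_measure)
  then have "emeasure Q {w \<in> space Q. classifier \<alpha> (fst w) \<noteq> snd w} = emeasure Q A"
    by (simp add: A_def)
  also have "\<dots> = (\<integral>\<^sup>+w. ennreal (dens Q w) * indicator A w \<partial>base_measure)"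
    by (subst Qd) (rule emeasure_density[OF m A])
  also have "\<dots> = (\<integral>\<^sup>+x. \<integral>\<^sup>+y. ennreal (dens Q (x, y)) * indicator A (x, y)
      \<partial>count_space {-1, 1} \<partial>restrict_space lborel {0..1})"
    unfolding base_measure_def using m A
    by (intro B.nn_integral_fst[symmetric]) (simp add: base_measure_def)
  also have "\<dots> = (\<integral>\<^sup>+x. ennreal (dens Q (x, if x < \<alpha> then 1 else -1))
      \<partial>restrict_space lborel {0..1})"
    by (intro nn_integral_cong)
       (auto simp: nn_integral_count_space_finite A_def Omega_def classifier_def
          space_restrict_space indicator_def)
  finally show ?thesis .
qed

lemma crossing_eq:
  assumes "Q \<in> P_class"
  shows "crossing Q \<in> {0..1}" "dens Q (crossing Q, 1) = dens Q (crossing Q, -1)"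
proof -
  have "\<exists>!x. x \<in> {0..1} \<and> dens Q (x, 1) = dens Q (x, -1)"
    using assms by (simp add: P_class_def)
  from theI'[OF this] show "crossing Q \<in> {0..1}" "dens Q (crossing Q, 1) = dens Q (crossing Q, -1)"
    by (simp_all add: crossing_def)
qed

text \<open>The factor 4 is 2 times 2: with \<open>r\<close> the distance of the threshold from the
  crossing, the integrands grow by at most \<open>2 * K * r\<close>, on an interval of length at
  most \<open>2 * r\<close>.\<close>

lemma pred_error_excess_le:
  assumes Q: "Q \<in> P_class"
    and K: "\<And>w. w \<in> Omega \<Longrightarrow> \<bar>partial1 (dens Q) w\<bar> \<le> K"
  shows "pred_error Q \<alpha> \<le> pred_error Q (crossing Q) + 4 * K * (\<alpha> - crossing Q)\<^sup>2"
proof -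
  define a where "a = crossing Q"
  define r where "r = \<bar>\<alpha> - a\<bar>"
  define R where "R = restrict_space lborel {0..1::real}"
  have Qt: "Q \<in> P_tilde" using Q by (simp add: P_class_def)
  then interpret prob_space Q by (simp add: P_tilde_def)
  have d: "is_C1_density Q (dens Q)" by (rule dens_is_C1_density[OF Qt])
  have C: "C1_Omega (dens Q)" using d by (simp add: is_C1_density_def)
  have K0: "0 \<le> K" using K[of "(0, 1)"] by (auto simp: Omega_def)
  have r0: "0 \<le> r" by (simp add: r_def)
  have pe: "ennreal (pred_error Q \<beta>) =
      (\<integral>\<^sup>+x. ennreal (dens Q (x, if x < \<beta> then 1 else -1)) \<partial>R)" for \<beta>
    using emeasure_misclassified[OF Qt, of \<beta>]
    by (simp add: pred_error_def emeasure_eq_measure R_def)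
  \<comment> \<open>\<open>C1_Omega\<close> gives continuity in \<open>x\<close> only for a fixed
    label. Measurability is therefore shown with the case distinction outside \<open>dens Q\<close>,
    which is then moved inside.\<close>
  have m: "(\<lambda>x. ennreal (dens Q (x, if x < a then 1 else -1))) \<in> borel_measurable R"
  proof -
    have "(\<lambda>x. dens Q (x, y)) \<in> borel_measurable R" if "y \<in> {-1, 1}" for y
      using borel_measurable_continuous_on_restrict[OF C1_Omega_continuous[OF C that]]
      unfolding R_def
      by (subst measurable_cong_sets[OF sets_restrict_space_cong[OF sets_lborel] refl])
    then have [measurable]: "(\<lambda>x. dens Q (x, 1)) \<in> borel_measurable R"
      "(\<lambda>x. dens Q (x, -1)) \<in> borel_measurable R" by auto
    have [measurable]: "(\<lambda>x. x) \<in> borel_measurable R"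
      unfolding R_def by (rule measurable_restrict_space1) simp
    have "(\<lambda>x. ennreal (if x < a then dens Q (x, 1) else dens Q (x, -1))) \<in> borel_measurable R"
      by measurable
    then show ?thesis by (simp add: if_distrib[of "\<lambda>y. dens Q (_, y)"] cong: if_cong)
  qed
  have iv: "{a - r..a + r} \<inter> {0..1} \<in> sets R"
    unfolding R_def by (auto simp: sets_restrict_space)
  \<comment> \<open>The excess is a summand on the right, which avoids subtraction in the extended
    nonnegative reals.\<close>
  have ptw: "ennreal (dens Q (x, if x < \<alpha> then 1 else -1)) \<le>
      ennreal (dens Q (x, if x < a then 1 else -1)) +
      ennreal (2 * K * r) * indicator ({a - r..a + r} \<inter> {0..1}) x" if x: "x \<in> {0..1}" for x
  proof (cases "(x < \<alpha>) = (x < a)")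
    case False
    \<comment> \<open>Here \<open>x\<close> separates \<open>\<alpha>\<close> from \<open>a\<close>,
      so it is no farther from \<open>a\<close> than \<open>\<alpha>\<close> is.\<close>
    then have xr: "\<bar>x - a\<bar> \<le> r" by (auto simp: r_def)
    have "\<bar>dens Q (x, y) - dens Q (a, y)\<bar> \<le> K * r" if "y \<in> {-1, 1}" for y
      using C1_Omega_lipschitz[OF C K that x crossing_eq(1)[OF Q]]
        mult_left_mono[OF xr K0] unfolding a_def by linarith
    \<comment> \<open>The two densities agree at \<open>a\<close>, and each moves by at most
      \<open>K * r\<close> between \<open>a\<close> and \<open>x\<close>.\<close>
    from this[of 1] this[of "-1"]
    have "\<bar>dens Q (x, 1) - dens Q (x, -1)\<bar> \<le> 2 * K * r"
      using crossing_eq(2)[OF Q] unfolding a_def by auto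
    then have "dens Q (x, if x < \<alpha> then 1 else -1) \<le>
        dens Q (x, if x < a then 1 else -1) + 2 * K * r"
      using K0 r0 by (auto split: if_splits)
    moreover have "0 \<le> dens Q (x, if x < a then 1 else -1)"
      using d x by (auto simp: is_C1_density_def Omega_def)
    moreover have "x \<in> {a - r..a + r} \<inter> {0..1}" using xr x by auto
    ultimately show ?thesis
      using K0 r0 by (simp add: ennreal_plus[symmetric] ennreal_leI del: ennreal_plus)
  qed simp
  have "emeasure R ({a - r..a + r} \<inter> {0..1}) = emeasure lborel ({a - r..a + r} \<inter> {0..1})"
    unfolding R_def by (subst emeasure_restrict_space) auto
  also have "\<dots> \<le> emeasure lborel {a - r..a + r}"
    by (intro emeasure_mono) auto
  also have "\<dots> = ennreal (2 * r)" using r0 by simp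
  finally have len: "emeasure R ({a - r..a + r} \<inter> {0..1}) \<le> ennreal (2 * r)" .
  have "ennreal (pred_error Q \<alpha>) \<le> (\<integral>\<^sup>+x. (ennreal (dens Q (x, if x < a then 1 else -1)) +
      ennreal (2 * K * r) * indicator ({a - r..a + r} \<inter> {0..1}) x) \<partial>R)"
    unfolding pe using ptw by (intro nn_integral_mono) (simp add: R_def space_restrict_space)
  also have "\<dots> = ennreal (pred_error Q a) +
      ennreal (2 * K * r) * emeasure R ({a - r..a + r} \<inter> {0..1})"
    unfolding pe using m iv by (simp add: nn_integral_add nn_integral_cmult_indicator)
  also have "\<dots> \<le> ennreal (pred_error Q a) + ennreal (2 * K * r) * ennreal (2 * r)"
    by (intro add_left_mono mult_left_mono len) simp
  also have "\<dots> = ennreal (pred_error Q a + 4 * K * (\<alpha> - a)\<^sup>2)"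
    using K0 r0 by (simp add: ennreal_mult[symmetric] ennreal_plus[symmetric] pred_error_def
        r_def power2_eq_square del: ennreal_plus flip: abs_mult)
  finally show ?thesis
    using K0 by (subst (asm) ennreal_le_iff) (auto simp: a_def pred_error_def)
qed

text \<open>The metric also controls derivatives, so within distance 1 the bound for
  \<open>P\<close> grows by at most 1. What matters is that \<open>K\<close> is independent of
  \<open>Q\<close>, in view of the supremum over \<open>Q\<close>.\<close>

lemma partial1_dens_bounded_near:
  assumes P: "P \<in> P_tilde"
  obtains K where "K > 0"
    "\<And>Q w. Q \<in> P_tilde \<Longrightarrow> dP P Q < 1 \<Longrightarrow> w \<in> Omega \<Longrightarrow> \<bar>partial1 (dens Q) w\<bar> \<le> K"
proof -
  have bd: "bdd_above ((\<lambda>w. \<bar>partial1 (dens P) w\<bar>) ` Omega)"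
    using dens_is_C1_density[OF P]
    by (intro bounded_Omega) (auto simp: is_C1_density_def C1_Omega_def)
  show thesis
  proof
    show "sup_norm (partial1 (dens P)) + 1 > 0"
      using sup_norm_nonneg[OF bd] by simp
    fix Q w assume Q: "Q \<in> P_tilde" and l: "dP P Q < 1" and w: "w \<in> Omega"
    show "\<bar>partial1 (dens Q) w\<bar> \<le> sup_norm (partial1 (dens P)) + 1"
      \<comment> \<open>The density summand of \<open>dP P Q\<close> is nonnegative, so the
        derivative summand alone is below 1.\<close>
      using sup_norm_upper[OF bd w] sup_norm_upper[OF bdd_dens_diff(2)[OF P Q] w]
        sup_norm_nonneg[OF bdd_dens_diff(1)[OF P Q]] l P Q
      by (auto simp: dP_def)
  qed
qed

text \<open>This shrinks the neighborhood given by the hypothesis to one where the derivative bound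
  is uniform. Metric balls are open, hence their traces on \<open>P_class\<close> are open in
  \<open>P_topology\<close>.\<close>

lemma nhd_of_Int_ball:
  assumes "nhd_of P N" "e > 0"
  shows "nhd_of P (N \<inter> {Q. dP P Q < e})"
proof -
  interpret Metric_space P_tilde dP by (rule Metric_space_P_tilde)
  from assms obtain U where U: "N \<subseteq> P_class" "openin P_topology U" "P \<in> U" "U \<subseteq> N"
    by (auto simp: nhd_of_def)
  have P: "P \<in> P_tilde" using U by (auto simp: P_class_def)
  have "openin P_topology (P_class \<inter> mball P e)"
    unfolding P_topology_def by (rule openin_subtopology_Int2) (rule openin_mball)
  from openin_Int[OF U(2) this] have "openin P_topology (U \<inter> (P_class \<inter> mball P e))" .
  moreover have "P \<in> U \<inter> (P_class \<inter> mball P e)"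
    using U P assms(2) by auto
  moreover have "U \<inter> (P_class \<inter> mball P e) \<subseteq> N \<inter> {Q. dP P Q < e}"
    using U by auto
  ultimately show ?thesis using U(1) unfolding nhd_of_def by blast
qed

text \<open>Multiply by \<open>(x powr (1/3))\<^sup>2\<close>, the reciprocal of
  \<open>x powr (-2/3)\<close>, and take square roots.\<close>

lemma cube_root_rate_of_quadratic_bound:
  fixes t c T x :: real
  assumes "c > 0" "T > 0" "x > 0" and gt: "T * x powr (-2/3) < c * t\<^sup>2"
  shows "sqrt (T / c) < x powr (1/3) * \<bar>t\<bar>"
proof -
  have "x powr (-2/3) * (x powr (1/3))\<^sup>2 = 1"
    using assms(3) by (simp add: power2_eq_square flip: powr_add)
  then have "T = T * x powr (-2/3) * (x powr (1/3))\<^sup>2" by (simp add: mult.assoc)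
  also have "\<dots> < c * t\<^sup>2 * (x powr (1/3))\<^sup>2"
    using gt assms(3) by (intro mult_strict_right_mono) auto
  finally have "T / c < (x powr (1/3) * \<bar>t\<bar>)\<^sup>2"
    using assms(1) by (simp add: field_simps power_mult_distrib)
  then show ?thesis by (intro real_less_lsqrt) auto
qed

theorem corollary1p6:
  fixes a_hat :: "nat \<Rightarrow> real \<Rightarrow> (nat \<Rightarrow> real \<times> real) \<Rightarrow> real"
  assumes estimators: "\<And>n L. n \<ge> 1 \<Longrightarrow> L > 0 \<Longrightarrow> estimator n (a_hat n L)"
    and tight: "\<forall>P\<in>P_class. \<exists>N'. nhd_of P N' \<and> (\<forall>T>0.
      ((\<lambda>L. SUP Q\<in>N'. limsup (\<lambda>n.
          emeasure (power_measure n Q)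
            {\<omega> \<in> space (power_measure n Q).
               real n powr (1/3) * \<bar>a_hat n L \<omega> - crossing Q\<bar> > T}))
        \<longlongrightarrow> 0) at_top)"
  shows "\<forall>P\<in>P_class. \<exists>N. nhd_of P N \<and> (\<forall>T>0.
      ((\<lambda>L. SUP Q\<in>N. limsup (\<lambda>n.
          emeasure (power_measure n Q)
            {\<omega> \<in> space (power_measure n Q).
               pred_error Q (a_hat n L \<omega>) > pred_error Q (crossing Q) + T * real n powr (-2/3)}))
        \<longlongrightarrow> 0) at_top)"
proof
  fix P assume P: "P \<in> P_class"
  then obtain N' where N': "nhd_of P N'"
    and lim: "\<And>T. T > 0 \<Longrightarrow> ((\<lambda>L. SUP Q\<in>N'. limsup (\<lambda>n. emeasure (power_measure n Q)
        {\<omega> \<in> space (power_measure n Q). real n powr (1/3) * \<bar>a_hat n L \<omega> - crossing Q\<bar> > T}))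
        \<longlongrightarrow> 0) at_top"
    using tight by blast
  obtain K where K: "K > 0"
    "\<And>Q w. Q \<in> P_tilde \<Longrightarrow> dP P Q < 1 \<Longrightarrow> w \<in> Omega \<Longrightarrow> \<bar>partial1 (dens Q) w\<bar> \<le> K"
    using partial1_dens_bounded_near[of P] P by (auto simp: P_class_def)
  define N where "N = N' \<inter> {Q. dP P Q < 1}"
  have "((\<lambda>L. SUP Q\<in>N. limsup (\<lambda>n. emeasure (power_measure n Q)
        {\<omega> \<in> space (power_measure n Q).
           pred_error Q (a_hat n L \<omega>) > pred_error Q (crossing Q) + T * real n powr (-2/3)}))
      \<longlongrightarrow> 0) at_top" (is "(?g \<longlongrightarrow> 0) at_top") if T: "T > 0" for T
  proof -
    \<comment> \<open>The level at which \<open>4 * K * S\<^sup>2 = T\<close>. It depends on neither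
      \<open>Q\<close>, \<open>L\<close> nor \<open>n\<close>, so the assumed limit applies at level
      \<open>S\<close>.\<close>
    define S where "S = sqrt (T / (4 * K))"
    have S: "S > 0" using T K(1) by (simp add: S_def)
    let ?f = "\<lambda>L. SUP Q\<in>N'. limsup (\<lambda>n. emeasure (power_measure n Q)
        {\<omega> \<in> space (power_measure n Q). real n powr (1/3) * \<bar>a_hat n L \<omega> - crossing Q\<bar> > S})"
    \<comment> \<open>Measurability of the estimators is given for positive \<open>L\<close>, which
      suffices for a limit at infinity.\<close>
    have "?g L \<le> ?f L" if L: "L > 0" for L
    proof (rule SUP_mono)
      fix Q assume Q: "Q \<in> N"
      then have QN: "Q \<in> N'" "dP P Q < 1" by (auto simp: N_def)
      then have QP: "Q \<in> P_class" using N' by (auto simp: nhd_of_def)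
      then have Qt: "Q \<in> P_tilde" by (simp add: P_class_def)
      \<comment> \<open>For \<open>n = 0\<close> the inclusion of events may fail, since
        \<open>0 powr (-2/3)\<close> is 0; the limsup ignores this index.\<close>
      have "emeasure (power_measure n Q) {\<omega> \<in> space (power_measure n Q).
            pred_error Q (a_hat n L \<omega>) > pred_error Q (crossing Q) + T * real n powr (-2/3)}
          \<le> emeasure (power_measure n Q) {\<omega> \<in> space (power_measure n Q).
            real n powr (1/3) * \<bar>a_hat n L \<omega> - crossing Q\<bar> > S}" if n: "n \<ge> 1" for n
      \<comment> \<open>The rule asks for measurability of the larger event, which follows from that
        of \<open>a_hat n L\<close>.\<close>
      proof (rule emeasure_mono)
        have "sets (power_measure n Q) = sets (Pi\<^sub>M {..<n} (\<lambda>_. Omega_borel))"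
          unfolding power_measure_def using Qt by (intro sets_PiM_cong) (auto simp: P_tilde_def)
        then have [measurable]: "a_hat n L \<in> borel_measurable (power_measure n Q)"
          using estimators[OF n L] by (simp add: estimator_def cong: measurable_cong_sets)
        show "{\<omega> \<in> space (power_measure n Q).
            real n powr (1/3) * \<bar>a_hat n L \<omega> - crossing Q\<bar> > S} \<in> sets (power_measure n Q)"
          by measurable
        show "{\<omega> \<in> space (power_measure n Q).
            pred_error Q (a_hat n L \<omega>) > pred_error Q (crossing Q) + T * real n powr (-2/3)}
          \<subseteq> {\<omega> \<in> space (power_measure n Q). real n powr (1/3) * \<bar>a_hat n L \<omega> - crossing Q\<bar> > S}"
        proof safe
          fix \<omega>
          assume "pred_error Q (a_hat n L \<omega>) > pred_error Q (crossing Q) + T * real n powr (-2/3)"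
          with pred_error_excess_le[OF QP K(2)[OF Qt QN(2)], of "a_hat n L \<omega>"]
          have "T * real n powr (-2/3) < (4 * K) * (a_hat n L \<omega> - crossing Q)\<^sup>2" by simp
          then show "S < real n powr (1/3) * \<bar>a_hat n L \<omega> - crossing Q\<bar>"
            unfolding S_def using K(1) T n by (intro cube_root_rate_of_quadratic_bound) auto
        qed
      qed
      \<comment> \<open>The witness is \<open>Q\<close> itself, as \<open>N\<close> is contained in
        \<open>N'\<close>.\<close>
      then show "\<exists>Q'\<in>N'. limsup (\<lambda>n. emeasure (power_measure n Q) {\<omega> \<in> space (power_measure n Q).
            pred_error Q (a_hat n L \<omega>) > pred_error Q (crossing Q) + T * real n powr (-2/3)})
          \<le> limsup (\<lambda>n. emeasure (power_measure n Q') {\<omega> \<in> space (power_measure n Q').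
            real n powr (1/3) * \<bar>a_hat n L \<omega> - crossing Q'\<bar> > S})"
        by (intro bexI[OF _ QN(1)] Limsup_mono eventually_sequentiallyI)
    qed
    then have "\<forall>\<^sub>F L in at_top. ?g L \<le> ?f L"
      by (rule eventually_mono[OF eventually_gt_at_top])
    then show ?thesis
      by (intro tendsto_sandwich[OF _ _ tendsto_const lim[OF S]]) auto
  qed
  moreover have "nhd_of P N"
    unfolding N_def by (rule nhd_of_Int_ball[OF N']) simp
  ultimately show "\<exists>N. nhd_of P N \<and> (\<forall>T>0. ((\<lambda>L. SUP Q\<in>N. limsup (\<lambda>n.
          emeasure (power_measure n Q) {\<omega> \<in> space (power_measure n Q).
             pred_error Q (a_hat n L \<omega>) > pred_error Q (crossing Q) + T * real n powr (-2/3)}))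
        \<longlongrightarrow> 0) at_top)" by blast
qed

end
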